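(* Let $n>1$ be an integer and let $(\mathcal{F},\mathcal{G})$ be a Cross-Sperner pair of families of subsets of $[n]=\{1,\dots,n\}$ such that $|\mathcal{I}(\mathcal{F},\mathcal{G})|=m(n)$. Then there exist disjoint sets $X,Y$ with $X\cup Y=[n]$ and $\{|X|,|Y|\}=\{\lfloor n/2\rfloor,\lceil n/2\rceil\}$ such that $\mathcal{F}=\{A\cup Y: A\subsetneq X\}$ and $\mathcal{G}=\{B\cup X: B\subsetneq Y\}$. In particular, $m(n)=2^n-2^{\lfloor n/2\rfloor}-2^{\lceil n/2\rceil}+1$ for all $n>1$.
   Context: A pair $(\mathcal{F},\mathcal{G})$ of families $\mathcal{F},\mathcal{G}\subseteq 2^{[n]}$ is called Cross-Sperner if for all $A\in\mathcal{F}$ and $B\in\mathcal{G}$, neither $A\subseteq B$ nor $B\subseteq A$. For families $\mathcal{F},\mathcal{G}$ set $\mathcal{I}(\mathcal{F},\mathcal{G})=\{A\cap B: A\in\mathcal{F},B\in\mathcal{G}\}$, and define $m(n)=\max\{|\mathcal{I}(\mathcal{F},\mathcal{G})|: \mathcal{F},\mathcal{G}\subseteq 2^{[n]}\text{ form a Cross-Sperner pair}\}$. Here $A\subsetneq X$ means $A$ is a proper subset of $X$ (possibly empty). *)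

theory Defs
  imports Main
begin

definition cross_sperner :: "'a set set \<Rightarrow> 'a set set \<Rightarrow> bool" where
  "cross_sperner \<F> \<G> \<longleftrightarrow> (\<forall>A\<in>\<F>. \<forall>B\<in>\<G>. \<not> A \<subseteq> B \<and> \<not> B \<subseteq> A)"

definition intersections :: "'a set set \<Rightarrow> 'a set set \<Rightarrow> 'a set set" where
  "intersections \<F> \<G> = {A \<inter> B | A B. A \<in> \<F> \<and> B \<in> \<G>}"

(* The empty families are allowed, so Max is taken over a nonempty (finite) set. *)
definition max_intersections :: "nat \<Rightarrow> nat" where
  "max_intersections n =
     Max {card (intersections \<F> \<G>) | \<F> \<G>.
            \<F> \<subseteq> Pow {1..n} \<and> \<G> \<subseteq> Pow {1..n} \<and> cross_sperner \<F> \<G>}"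

end

(*
  Let \<U> be the up-closure of \<F> and \<E> the up-closure of \<G> minus \<U>, together with [n]. The family
  I(\<F>,\<G>), \<U> and \<E> lie in I(\<U>,\<E>), with no overlap except [n] in \<U> and \<E>; hence
  |I(\<F>,\<G>)| + |\<U>| + |\<E>| - 1 <= |I(\<U>,\<E>)|. For even n, |I(\<U>,\<E>)| <= |\<U>||\<E>| and AM-GM bound
  |I(\<F>,\<G>)|. For n = 2k+1 AM-GM loses a constant factor in the error term, and it is replaced by
    |I(\<U>,\<E>)| <= 2^k (|\<U>| + |\<E>|) - 4^k,   if |\<U>| >= 2^k or |\<E>| >= 2^k,
  which holds for up-closed \<U> and arbitrary \<E> and follows by induction on the ground set from the
  unbalanced version with 2^k, 2^k replaced by \<alpha>, \<beta> where 2 \<alpha> \<beta> = 2^n. In both cases a pair at least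
  as good as the construction has I(\<U>,\<E>) = 2^[n]. So the empty set is in I(\<U>,\<E>), and there are
  disjoint A in \<F>, B in \<G>. No member of I(\<F>,\<G>) contains A or B, which gives the bound, and in the
  case of equality I(\<F>,\<G>) consists of all sets containing neither B nor its complement A.
*)

theory Submission
  imports Defs Complex_Main
begin

section \<open>Up-closed families and their sections at a point\<close>

definition up_closed :: "'a set \<Rightarrow> 'a set set \<Rightarrow> bool" where
  "up_closed V \<U> \<longleftrightarrow> \<U> \<subseteq> Pow V \<and> (\<forall>A\<in>\<U>. \<forall>B. A \<subseteq> B \<and> B \<subseteq> V \<longrightarrow> B \<in> \<U>)"

definition up_closure :: "'a set \<Rightarrow> 'a set set \<Rightarrow> 'a set set" where
  "up_closure V \<F> = {S. S \<subseteq> V \<and> (\<exists>A\<in>\<F>. A \<subseteq> S)}"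

text \<open>\<open>link\<close> and \<open>deletion\<close> are meant as for simplicial complexes:
  both halves of a family live on the ground set without \<open>z\<close>, where an induction
  hypothesis applies.\<close>

definition link :: "'a \<Rightarrow> 'a set set \<Rightarrow> 'a set set" where
  "link z \<S> = {A. z \<notin> A \<and> insert z A \<in> \<S>}"

definition deletion :: "'a \<Rightarrow> 'a set set \<Rightarrow> 'a set set" where
  "deletion z \<S> = {A \<in> \<S>. z \<notin> A}"

lemma link_subset_Pow: "\<S> \<subseteq> Pow (insert z V) \<Longrightarrow> link z \<S> \<subseteq> Pow V"
  and deletion_subset_Pow: "\<S> \<subseteq> Pow (insert z V) \<Longrightarrow> deletion z \<S> \<subseteq> Pow V"
  by (auto simp: link_def deletion_def)

lemma finite_subset_Pow: "finite V \<Longrightarrow> \<S> \<subseteq> Pow V \<Longrightarrow> finite \<S>"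
  by (meson finite_Pow_iff finite_subset)

lemma card_link_deletion:
  assumes "finite \<S>"
  shows "card \<S> = card (link z \<S>) + card (deletion z \<S>)"
proof -
  have eq: "\<S> = insert z ` link z \<S> \<union> deletion z \<S>"
  proof (intro set_eqI iffI)
    fix A assume "A \<in> \<S>"
    then show "A \<in> insert z ` link z \<S> \<union> deletion z \<S>"
      by (cases "z \<in> A")
        (auto simp: link_def deletion_def insert_absorb intro!: image_eqI[of _ _ "A - {z}"])
  qed (auto simp: link_def deletion_def)
  have inj: "inj_on (insert z) (link z \<S>)"
    by (auto simp: inj_on_def link_def)
  have "finite (link z \<S>)"
    by (rule finite_imageD[OF finite_subset[OF _ assms] inj]) (auto simp: link_def)
  moreover have "finite (deletion z \<S>)"
    using assms by (simp add: deletion_def)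
  ultimately have "card (insert z ` link z \<S> \<union> deletion z \<S>) = card (insert z ` link z \<S>) + card (deletion z \<S>)"
    by (intro card_Un_disjoint) (auto simp: deletion_def)
  then show ?thesis
    using eq card_image[OF inj] by simp
qed

lemma up_closedD: "up_closed V \<U> \<Longrightarrow> A \<in> \<U> \<Longrightarrow> A \<subseteq> B \<Longrightarrow> B \<subseteq> V \<Longrightarrow> B \<in> \<U>"
  by (auto simp: up_closed_def)

lemma up_closed_subset_Pow: "up_closed V \<U> \<Longrightarrow> \<U> \<subseteq> Pow V"
  by (simp add: up_closed_def)

lemma up_closed_link:
  assumes "up_closed (insert z V) \<U>" "z \<notin> V"
  shows "up_closed V (link z \<U>)"
  unfolding up_closed_def
proof (intro conjI ballI allI impI)
  show "link z \<U> \<subseteq> Pow V"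
    using assms by (intro link_subset_Pow) (simp add: up_closed_def)
  fix A B assume A: "A \<in> link z \<U>" and B: "A \<subseteq> B \<and> B \<subseteq> V"
  have "insert z B \<in> \<U>"
    by (rule up_closedD[OF assms(1), of "insert z A"]) (use A B in \<open>auto simp: link_def\<close>)
  then show "B \<in> link z \<U>" using B assms(2) by (auto simp: link_def)
qed

lemma up_closed_deletion:
  assumes "up_closed (insert z V) \<U>" "z \<notin> V"
  shows "up_closed V (deletion z \<U>)"
  unfolding up_closed_def
proof (intro conjI ballI allI impI)
  show "deletion z \<U> \<subseteq> Pow V"
    using assms by (intro deletion_subset_Pow) (simp add: up_closed_def)
  fix A B assume A: "A \<in> deletion z \<U>" and B: "A \<subseteq> B \<and> B \<subseteq> V"
  have "B \<in> \<U>"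
    by (rule up_closedD[OF assms(1), of A]) (use A B in \<open>auto simp: deletion_def\<close>)
  then show "B \<in> deletion z \<U>" using B assms(2) by (auto simp: deletion_def)
qed

text \<open>Up-closedness enters the induction through this inclusion: it absorbs one of the four
  pairs of sections and orders the two section sizes.\<close>

lemma deletion_subset_link:
  assumes "up_closed (insert z V) \<U>"
  shows "deletion z \<U> \<subseteq> link z \<U>"
proof
  fix A assume "A \<in> deletion z \<U>"
  then have A: "A \<in> \<U>" "z \<notin> A" by (simp_all add: deletion_def)
  moreover have "insert z A \<subseteq> insert z V"
    using A up_closed_subset_Pow[OF assms] by blast
  ultimately show "A \<in> link z \<U>"
    using up_closedD[OF assms A(1) subset_insertI] by (simp add: link_def)
qed

section \<open>Families of intersections: splitting at a point and a linear bound\<close>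

lemma intersections_subset_Pow:
  "\<F> \<subseteq> Pow V \<Longrightarrow> intersections \<F> \<G> \<subseteq> Pow V"
  by (auto simp: intersections_def)

lemma intersections_eq_image: "intersections \<F> \<G> = (\<lambda>(A, B). A \<inter> B) ` (\<F> \<times> \<G>)"
  by (auto simp: intersections_def)

lemma card_intersections_le_mult:
  "finite \<F> \<Longrightarrow> finite \<G> \<Longrightarrow> card (intersections \<F> \<G>) \<le> card \<F> * card \<G>"
  unfolding intersections_eq_image
  using card_image_le[of "\<F> \<times> \<G>"] by (simp add: card_cartesian_product)

text \<open>An intersection contains \<open>z\<close> exactly when both of its parts do.\<close>

lemma link_intersections:
  "link z (intersections \<U> \<E>) = intersections (link z \<U>) (link z \<E>)"
proof (intro set_eqI iffI)
  fix S assume "S \<in> link z (intersections \<U> \<E>)"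
  then obtain A B where AB: "z \<notin> S" "insert z S = A \<inter> B" "A \<in> \<U>" "B \<in> \<E>"
    by (auto simp: link_def intersections_def)
  then have "S = (A - {z}) \<inter> (B - {z})" "insert z (A - {z}) = A" "insert z (B - {z}) = B"
    by blast+
  moreover from this AB have "A - {z} \<in> link z \<U>" "B - {z} \<in> link z \<E>"
    unfolding link_def by simp_all
  ultimately show "S \<in> intersections (link z \<U>) (link z \<E>)"
    unfolding intersections_def by blast
next
  fix S assume "S \<in> intersections (link z \<U>) (link z \<E>)"
  then obtain A B where AB: "S = A \<inter> B" "z \<notin> A" "insert z A \<in> \<U>" "insert z B \<in> \<E>"
    by (auto simp: link_def intersections_def)
  then have "insert z S = insert z A \<inter> insert z B" "z \<notin> S" by auto
  with AB show "S \<in> link z (intersections \<U> \<E>)"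
    unfolding link_def intersections_def by blast
qed

text \<open>Pairs avoiding \<open>z\<close> on both sides are absorbed, since \<open>\<U>\<close> is up-closed.\<close>

lemma deletion_intersections:
  assumes "up_closed (insert z V) \<U>"
  shows "deletion z (intersections \<U> \<E>) \<subseteq>
    intersections (deletion z \<U>) (link z \<E>) \<union> intersections (link z \<U>) (deletion z \<E>)"
proof
  fix S assume "S \<in> deletion z (intersections \<U> \<E>)"
  then obtain A B where AB: "z \<notin> A \<inter> B" "S = A \<inter> B" "A \<in> \<U>" "B \<in> \<E>"
    by (auto simp: deletion_def intersections_def)
  show "S \<in> intersections (deletion z \<U>) (link z \<E>) \<union> intersections (link z \<U>) (deletion z \<E>)"
  proof (cases "z \<in> B")
    case True
    then have "S = A \<inter> (B - {z})" "A \<in> deletion z \<U>" "B - {z} \<in> link z \<E>"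
      using AB by (auto simp: deletion_def link_def insert_absorb)
    then show ?thesis by (auto simp: intersections_def)
  next
    case False
    have "A - {z} \<in> link z \<U>"
    proof (cases "z \<in> A")
      case True
      then show ?thesis using AB by (auto simp: link_def insert_absorb)
    next
      case False
      then show ?thesis
        using deletion_subset_link[OF assms] AB by (auto simp: deletion_def)
    qed
    moreover have "S = (A - {z}) \<inter> B" "B \<in> deletion z \<E>"
      using AB False by (auto simp: deletion_def)
    ultimately show ?thesis by (auto simp: intersections_def)
  qed
qed

text \<open>The recursion behind the induction on the ground set. Only three of the four pairs of
  sections appear, since two deletions produce nothing new.\<close>

lemma card_intersections_split:
  assumes V: "finite V" "z \<notin> V" and U: "up_closed (insert z V) \<U>" and E: "\<E> \<subseteq> Pow (insert z V)"
  shows "card (intersections \<U> \<E>) \<le> card (intersections (link z \<U>) (link z \<E>))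
      + card (intersections (deletion z \<U>) (link z \<E>)) + card (intersections (link z \<U>) (deletion z \<E>))"
proof -
  have U': "\<U> \<subseteq> Pow (insert z V)" using U by (simp add: up_closed_def)
  have fin: "finite (intersections (deletion z \<U>) (link z \<E>) \<union> intersections (link z \<U>) (deletion z \<E>))"
    using V link_subset_Pow[OF U'] deletion_subset_Pow[OF U']
    by (meson finite_UnI finite_subset_Pow intersections_subset_Pow)
  have "finite (intersections \<U> \<E>)"
    using V U' by (meson finite.insertI finite_subset_Pow intersections_subset_Pow)
  from card_link_deletion[OF this, of z]
  have "card (intersections \<U> \<E>) = card (intersections (link z \<U>) (link z \<E>)) + card (deletion z (intersections \<U> \<E>))"
    by (simp add: link_intersections)
  also have "card (deletion z (intersections \<U> \<E>))
      \<le> card (intersections (deletion z \<U>) (link z \<E>) \<union> intersections (link z \<U>) (deletion z \<E>))"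
    by (rule card_mono[OF fin deletion_intersections[OF U]])
  also have "\<dots> \<le> card (intersections (deletion z \<U>) (link z \<E>)) + card (intersections (link z \<U>) (deletion z \<E>))"
    by (rule card_Un_le)
  finally show ?thesis by simp
qed

text \<open>The bound is an equality for \<open>\<U> = {A. X \<subseteq> A}\<close> and \<open>\<E> = {B. V - X \<subseteq> B}\<close> when \<open>\<alpha>\<close> is
  \<open>card \<U>\<close> or \<open>card \<U> / 2\<close>. That \<open>\<alpha>\<close> is a power of two (with possibly negative exponent) matters only
  for \<open>V = {}\<close>, where \<open>1 \<le> \<alpha> + \<beta> - \<alpha> * \<beta>\<close> would fail for \<open>1/2 < \<alpha> < 1\<close>.\<close>

lemma card_intersections_up_closed_le:
  fixes \<alpha> \<beta> :: real
  assumes "finite V" "up_closed V \<U>" "\<E> \<subseteq> Pow V"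
    and "\<alpha> = 2 ^ i / 2 ^ j" "2 * \<alpha> * \<beta> = 2 ^ card V"
    and "\<alpha> \<le> card \<U> \<or> \<beta> \<le> card \<E>"
  shows "card (intersections \<U> \<E>) \<le> \<beta> * card \<U> + \<alpha> * card \<E> - \<alpha> * \<beta>"
  using assms
proof (induction V arbitrary: \<U> \<E> \<alpha> \<beta> i j rule: finite_induct)
  case empty
  have \<alpha>: "\<alpha> > 0" using empty.prems(3) by simp
  have ab: "\<alpha> * \<beta> = 1/2" using empty.prems(4) by simp
  then have \<beta>: "\<beta> > 0" using \<alpha> zero_less_mult_pos[of \<alpha> \<beta>] by simp
  have fin: "finite \<U>" "finite \<E>"
    using empty finite_subset_Pow[of "{}"] by (auto simp: up_closed_def)
  have le1: "card \<U> \<le> 1" "card \<E> \<le> 1"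
    using empty card_mono[of "{{}}"] by (auto simp: up_closed_def)
  have N: "card (intersections \<U> \<E>) \<le> card \<U> * card \<E>"
    by (rule card_intersections_le_mult[OF fin])
  have "\<alpha> \<le> 1/2 \<or> 1 \<le> \<alpha>"
  proof (cases "j \<le> i")
    case True
    then have "(2::real) ^ j \<le> 2 ^ i" by (intro power_increasing) auto
    then have "1 \<le> \<alpha>" unfolding empty.prems(3) by (simp only: le_divide_eq_1_pos zero_less_power zero_less_numeral)
    then show ?thesis ..
  next
    case False
    then have "(2::real) ^ Suc i \<le> 2 ^ j" by (intro power_increasing) auto
    then have "\<alpha> \<le> 1/2" unfolding empty.prems(3) by (simp add: divide_le_eq)
    then show ?thesis ..
  qed
  \<comment> \<open>As \<open>\<alpha> * \<beta> = 1/2\<close>, this quadratic is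
    \<open>\<alpha> * (\<alpha> + \<beta> - 3/2)\<close>; the value \<open>3/2\<close> is what the
    case of two singleton families requires.\<close>
  then have "0 \<le> (\<alpha> - 1) * (\<alpha> - 1/2)"
    by (auto simp: zero_le_mult_iff)
  then have "0 \<le> \<alpha> * (\<alpha> + \<beta> - 3/2)" using ab by (simp add: algebra_simps diff_divide_distrib)
  then have sum: "\<alpha> + \<beta> \<ge> 3/2" using \<alpha> by (simp add: zero_le_mult_iff)
  consider "card \<U> = 1" "card \<E> = 1" | "card \<U> = 0" "card \<E> = 1" | "card \<U> = 1" "card \<E> = 0"
  proof -
    have "card \<U> = 0 \<or> card \<U> = 1" "card \<E> = 0 \<or> card \<E> = 1" using le1 by linarith+
    moreover have "\<not> (card \<U> = 0 \<and> card \<E> = 0)" using empty.prems(5) \<alpha> \<beta> by auto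
    ultimately show ?thesis using that by blast
  qed
  then show ?case
  proof cases
    case 1
    then show ?thesis using N sum ab by simp
  next
    case 2
    then have "\<alpha> * \<beta> \<le> \<alpha> * 1" using empty.prems(5) 2 \<alpha> by (intro mult_left_mono) auto
    then show ?thesis using N 2 by simp
  next
    case 3
    then have "\<alpha> * \<beta> \<le> 1 * \<beta>" using empty.prems(5) 3 \<beta> by (intro mult_right_mono) auto
    then show ?thesis using N 3 by simp
  qed
next
  case (insert z V)
  have \<alpha>: "\<alpha> > 0" using insert.prems(3) by simp
  have ab: "\<alpha> * \<beta> = 2 ^ card V" using insert.prems(4) insert.hyps by simp
  then have \<beta>: "\<beta> > 0" using \<alpha> zero_less_mult_pos[of \<alpha> \<beta>] by simp
  note U = \<open>up_closed (insert z V) \<U>\<close> and E = \<open>\<E> \<subseteq> Pow (insert z V)\<close>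
  have U': "\<U> \<subseteq> Pow (insert z V)" using U by (simp add: up_closed_def)
  have finU: "finite \<U>" and finE: "finite \<E>"
    using finite_subset_Pow[of "insert z V"] insert.hyps(1) U' E by simp_all
  define U1 U0 E1 E0 where defs: "U1 = link z \<U>" "U0 = deletion z \<U>" "E1 = link z \<E>" "E0 = deletion z \<E>"
  have up1: "up_closed V U1" and up0: "up_closed V U0"
    using U insert.hyps by (simp_all add: defs up_closed_link up_closed_deletion)
  have sub: "E1 \<subseteq> Pow V" "E0 \<subseteq> Pow V"
    using E by (simp_all add: defs link_subset_Pow deletion_subset_Pow)
  have fin: "finite U1" "finite U0" "finite E1" "finite E0"
    using finite_subset_Pow[OF insert.hyps(1)] up1 up0 sub by (simp_all add: up_closed_def)
  \<comment> \<open>The indices run opposite to those of the families: \<open>f0\<close>,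
    \<open>g0\<close> count the links and \<open>f1\<close>, \<open>g1\<close> the
    deletions.\<close>
  define f0 f1 g0 g1 :: real where fg: "f0 = card U1" "f1 = card U0" "g0 = card E1" "g1 = card E0"
  have f: "real (card \<U>) = f0 + f1" and g: "real (card \<E>) = g0 + g1"
    using card_link_deletion[OF finU, of z] card_link_deletion[OF finE, of z] by (simp_all add: fg defs)
  have nn: "0 \<le> f0" "0 \<le> f1" "0 \<le> g0" "0 \<le> g1" by (simp_all add: fg)
  have f10: "f1 \<le> f0"
    using card_mono[OF fin(1), of U0] deletion_subset_link[OF U] by (simp add: fg defs)
  define N where "N = real (card (intersections \<U> \<E>))"
  define N11 N01 N10 where Ns: "N11 = real (card (intersections U1 E1))"
    "N01 = real (card (intersections U0 E1))" "N10 = real (card (intersections U1 E0))"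
  have N_split: "N \<le> N11 + N01 + N10"
    using card_intersections_split[OF insert.hyps(1,2) U E]
    unfolding N_def Ns defs by linarith
  have prods: "N11 \<le> f0 * g0" "N01 \<le> f1 * g0" "N10 \<le> f0 * g1"
    using fin by (simp_all add: Ns fg card_intersections_le_mult flip: of_nat_mult)
  have N_prod: "N \<le> (f0 + f1) * (g0 + g1)"
    unfolding N_def f[symmetric] g[symmetric] of_nat_mult[symmetric]
    using card_intersections_le_mult[OF finU finE] of_nat_le_iff by blast
  have "real (card \<S>) \<le> 2 ^ card W" if "\<S> \<subseteq> Pow W" "finite W" for \<S> :: "'a set set" and W
    using card_mono[OF _ that(1)] that(2) by (simp add: card_Pow flip: of_nat_le_iff)
  note card_le = this[OF intersections_subset_Pow]
  have N11_le: "N11 \<le> \<alpha> * \<beta>"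
    unfolding Ns ab using up1 insert.hyps by (intro card_le) (simp_all add: up_closed_def)
  have N_le: "N \<le> 2 * (\<alpha> * \<beta>)"
    using card_le[OF U', of \<E>] insert.hyps unfolding N_def ab by simp
  \<comment> \<open>Removing \<open>z\<close> halves the required product, so the induction
    hypothesis applies with either parameter halved. This freedom is the reason for the unbalanced
    statement.\<close>
  have IH1: "real (card (intersections \<A> \<B>)) \<le> \<beta> * card \<A> + \<alpha> / 2 * card \<B> - \<alpha> / 2 * \<beta>"
    if "up_closed V \<A>" "\<B> \<subseteq> Pow V" "\<alpha> / 2 \<le> card \<A> \<or> \<beta> \<le> card \<B>" for \<A> \<B>
    by (rule insert.IH[OF that(1,2) _ _ that(3), of i "Suc j"]) (use insert.prems ab in auto)
  have IH2: "real (card (intersections \<A> \<B>)) \<le> \<beta> / 2 * card \<A> + \<alpha> * card \<B> - \<alpha> * (\<beta> / 2)"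
    if "up_closed V \<A>" "\<B> \<subseteq> Pow V" "\<alpha> \<le> card \<A> \<or> \<beta> / 2 \<le> card \<B>" for \<A> \<B>
    by (rule insert.IH[OF that(1,2) _ _ that(3), of i j]) (use insert.prems ab in auto)
  have "N \<le> \<beta> * (f0 + f1) + \<alpha> * (g0 + g1) - \<alpha> * \<beta>"
  proof (cases "\<alpha> \<le> f0 + f1 \<and> \<beta> \<le> g0 + g1")
    case False
    \<comment> \<open>One factor is negative and the other nonnegative by the threshold hypothesis.
      Expanded, this turns the product bound into the claim.\<close>
    then have "(f0 + f1 - \<alpha>) * (g0 + g1 - \<beta>) \<le> 0"
      using insert.prems f g by (intro mult_le_0_iff[THEN iffD2]) auto
    then show ?thesis using N_prod by (simp add: algebra_simps)
  next
    case ge: True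
    \<comment> \<open>In A the two pairs with \<open>U1\<close> use \<open>IH2\<close>, in C the two
      pairs with \<open>E1\<close> use \<open>IH1\<close>; the halved terms add up to whole ones,
      and the remaining pair gets the product bound. B and D are settled by counting alone.\<close>
    consider (A) "\<alpha> \<le> f0" "g0 \<le> \<beta>" | (B) "\<alpha> \<le> f0" "\<beta> < g0"
      | (C) "f0 < \<alpha>" "\<alpha> / 2 \<le> f1 \<or> \<beta> \<le> g0" | (D) "f0 < \<alpha>" "g0 < \<beta>"
      by linarith
    then show ?thesis
    proof cases
      case A
      have "N11 \<le> \<beta> / 2 * f0 + \<alpha> * g0 - \<alpha> * (\<beta> / 2)" "N10 \<le> \<beta> / 2 * f0 + \<alpha> * g1 - \<alpha> * (\<beta> / 2)"
        using IH2[OF up1 sub(1)] IH2[OF up1 sub(2)] A by (simp_all add: Ns fg)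
      moreover have "f1 * g0 \<le> f1 * \<beta>" using A nn by (intro mult_left_mono) auto
      ultimately show ?thesis using N_split prods by (simp add: algebra_simps)
    next
      case B
      show ?thesis
      \<comment> \<open>Either the right-hand side reaches \<open>2 * (\<alpha> * \<beta>)\<close>,
        the number of all subsets of \<open>insert z V\<close>, or there is so little room that
        \<open>f1 \<le> \<alpha>\<close> and \<open>g1 \<le> \<beta>\<close>.\<close>
      proof (cases "3 * (\<alpha> * \<beta>) \<le> \<beta> * (f0 + f1) + \<alpha> * (g0 + g1)")
        case True
        then show ?thesis using N_le by linarith
      next
        case False
        have "\<beta> * \<alpha> \<le> \<beta> * f0" "\<alpha> * \<beta> \<le> \<alpha> * g0" "0 \<le> \<beta> * f1" "0 \<le> \<alpha> * g1"
          using B \<alpha> \<beta> nn by auto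
        then have "\<beta> * f1 \<le> \<beta> * \<alpha>" "\<alpha> * g1 \<le> \<alpha> * \<beta>"
          using False by (simp_all add: algebra_simps)
        then have "f1 \<le> \<alpha>" "g1 \<le> \<beta>" using \<alpha> \<beta> by auto
        then have "f1 * (g0 - \<beta>) \<le> \<alpha> * (g0 - \<beta>)" "(f0 - \<alpha>) * g1 \<le> (f0 - \<alpha>) * \<beta>"
          using B by (auto intro: mult_left_mono mult_right_mono)
        then show ?thesis using N_split N11_le prods by (simp add: algebra_simps)
      qed
    next
      case C
      have "\<alpha> / 2 \<le> f0" using ge f10 by linarith
      then have "N11 \<le> \<beta> * f0 + \<alpha> / 2 * g0 - \<alpha> / 2 * \<beta>" "N01 \<le> \<beta> * f1 + \<alpha> / 2 * g0 - \<alpha> / 2 * \<beta>"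
        using IH1[OF up1 sub(1)] IH1[OF up0 sub(1)] C by (simp_all add: Ns fg)
      moreover have "f0 * g1 \<le> \<alpha> * g1" using C nn by (intro mult_right_mono) auto
      ultimately show ?thesis using N_split prods by (simp add: algebra_simps)
    next
      case D
      \<comment> \<open>The three product bounds sum to the full product less
        \<open>f1 * g1\<close>, so this inequality is exactly what is missing.\<close>
      have "(f0 + f1 - \<alpha>) * (g0 + g1 - \<beta>) \<le> f1 * g1"
        using D ge nn by (intro mult_mono) auto
      then show ?thesis using N_split prods by (simp add: algebra_simps)
    qed
  qed
  then show ?case by (simp add: N_def f g)
qed

section \<open>Cross-Sperner pairs and their up-closures\<close>

lemma up_closed_up_closure: "up_closed V (up_closure V \<F>)"
  unfolding up_closed_def up_closure_def by blast

lemma intersections_commute: "intersections \<F> \<G> = intersections \<G> \<F>"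
  unfolding intersections_def by blast

lemma cross_sperner_commute: "cross_sperner \<F> \<G> \<longleftrightarrow> cross_sperner \<G> \<F>"
  unfolding cross_sperner_def by blast

text \<open>A member of \<open>\<F>\<close> inside \<open>A \<inter> B\<close> would lie in
  \<open>B\<close>, and one of \<open>\<G>\<close> would lie in \<open>A\<close>; hence no such
  intersection lies in either up-closure. Adding \<open>V\<close> to \<open>\<E>\<close> makes every
  member of \<open>\<U>\<close> an intersection, and \<open>V\<close> is the single overlap that
  accounts for the \<open>+ 1\<close>.\<close>

lemma card_intersections_cross_sperner:
  assumes V: "finite V" and F: "\<F> \<subseteq> Pow V" "\<F> \<noteq> {}" and G: "\<G> \<subseteq> Pow V" and cs: "cross_sperner \<F> \<G>"
  defines "\<U> \<equiv> up_closure V \<F>"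
  defines "\<E> \<equiv> insert V (up_closure V \<G> - \<U>)"
  shows "card (intersections \<F> \<G>) + card \<U> + card \<E> \<le> card (intersections \<U> \<E>) + 1"
proof -
  have VU: "V \<in> \<U>" using F unfolding \<U>_def up_closure_def by blast
  have UE: "\<U> \<subseteq> Pow V" "\<E> \<subseteq> Pow V" unfolding \<U>_def \<E>_def up_closure_def by blast+
  have FU: "\<F> \<subseteq> \<U>" using F unfolding \<U>_def up_closure_def by blast
  have GE: "\<G> \<subseteq> \<E>"
  proof
    fix B assume B: "B \<in> \<G>"
    then have "B \<notin> \<U>" using cs by (auto simp: \<U>_def up_closure_def cross_sperner_def)
    then show "B \<in> \<E>" using B G by (auto simp: \<E>_def up_closure_def)
  qed
  have VE: "V \<in> \<E>" by (simp add: \<E>_def)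
  have "A = A \<inter> V" if "A \<in> \<U>" for A using that UE by blast
  then have "\<U> \<subseteq> intersections \<U> \<E>" using VE unfolding intersections_def by blast
  moreover have "B = V \<inter> B" if "B \<in> \<E>" for B using that UE by blast
  then have "\<E> \<subseteq> intersections \<U> \<E>" using VU unfolding intersections_def by blast
  moreover have "intersections \<F> \<G> \<subseteq> intersections \<U> \<E>"
    using FU GE unfolding intersections_def by blast
  ultimately have sub: "intersections \<F> \<G> \<union> (\<U> \<union> \<E>) \<subseteq> intersections \<U> \<E>" by blast
  have disj: "intersections \<F> \<G> \<inter> (\<U> \<union> \<E>) = {}"
  proof -
    have "A \<inter> B \<notin> \<U> \<union> \<E>" if "A \<in> \<F>" "B \<in> \<G>" for A B
    proof -
      have "\<not> C \<subseteq> A \<inter> B" if "C \<in> \<F> \<union> \<G>" for C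
        using that cs \<open>A \<in> \<F>\<close> \<open>B \<in> \<G>\<close> by (auto simp: cross_sperner_def)
      then have "A \<inter> B \<notin> \<U>" "A \<inter> B \<notin> up_closure V \<G>"
        by (auto simp: \<U>_def up_closure_def)
      then show ?thesis using VU unfolding \<E>_def by auto
    qed
    then show ?thesis by (auto simp: intersections_def simp del: Un_iff)
  qed
  have fin: "finite \<U>" "finite \<E>" "finite (intersections \<F> \<G>)" "finite (intersections \<U> \<E>)"
    using finite_subset_Pow[OF V] UE intersections_subset_Pow[OF UE(1)]
      intersections_subset_Pow[OF F(1)] by simp_all
  have "\<U> \<inter> \<E> = {V}" using VU unfolding \<E>_def by blast
  then have "card \<U> + card \<E> = card (\<U> \<union> \<E>) + 1"
    using card_Un_Int[OF fin(1,2)] by simp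
  moreover have "card (intersections \<F> \<G>) + card (\<U> \<union> \<E>) \<le> card (intersections \<U> \<E>)"
    using card_mono[OF fin(4) sub] card_Un_disjoint[OF fin(3) _ disj] fin by simp
  ultimately show ?thesis by linarith
qed

text \<open>The core is \<open>ue_ge\<close>: once \<open>u + e\<close> is at least
  \<open>P + Q\<close>, the preceding inequality gives
  \<open>N \<ge> (P - 1) * (Q - 1) + P + Q - 1 = P * Q\<close>, so every subset of \<open>V\<close>
  is an intersection, including the empty one.\<close>

lemma cross_sperner_disjoint_members:
  fixes n :: nat
  assumes V: "finite V" "card V = n" and n: "n > 1"
    and F: "\<F> \<subseteq> Pow V" and G: "\<G> \<subseteq> Pow V" and cs: "cross_sperner \<F> \<G>"
    and large: "(2 ^ (n div 2) - 1) * (2 ^ ((n + 1) div 2) - 1) \<le> card (intersections \<F> \<G>)"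
  shows "\<exists>A\<in>\<F>. \<exists>B\<in>\<G>. A \<inter> B = {}"
proof -
  define p q where pq: "p = n div 2" "q = (n + 1) div 2"
  define P Q :: real where PQ: "P = 2 ^ p" "Q = 2 ^ q"
  have pq_sum: "p + q = n" "1 \<le> p" "1 \<le> q" using n by (auto simp: pq)
  have "2 ^ 1 \<le> P" "2 ^ 1 \<le> Q" unfolding PQ using pq_sum by (intro power_increasing; simp)+
  then have P2: "2 \<le> P" and Q2: "2 \<le> Q" by simp_all
  have PQ_mult: "P * Q = 2 ^ n" using pq_sum by (simp add: PQ flip: power_add)
  define \<U> where "\<U> = up_closure V \<F>"
  define \<E> where "\<E> = insert V (up_closure V \<G> - \<U>)"
  define u e where ue: "u = real (card \<U>)" "e = real (card \<E>)"
  define N where "N = real (card (intersections \<U> \<E>))"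
  define c where "c = real (card (intersections \<F> \<G>))"
  have "real ((2 ^ p - 1) * (2 ^ q - 1)) = (P - 1) * (Q - 1)"
    by (simp add: PQ of_nat_diff)
  then have c_ge: "(P - 1) * (Q - 1) \<le> c"
    using large unfolding c_def pq by (metis of_nat_le_iff)
  \<comment> \<open>Since \<open>n > 1\<close>, the assumed lower bound is positive, so neither
    family is empty.\<close>
  moreover have "1 * 1 \<le> (P - 1) * (Q - 1)"
    using P2 Q2 by (intro mult_mono) auto
  ultimately have "intersections \<F> \<G> \<noteq> {}" by (auto simp: c_def)
  then have nonempty: "\<F> \<noteq> {}" "\<G> \<noteq> {}" by (auto simp: intersections_def)
  have UE: "\<U> \<subseteq> Pow V" "\<E> \<subseteq> Pow V" unfolding \<U>_def \<E>_def up_closure_def by blast+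
  have fin: "finite \<U>" "finite \<E>" using finite_subset_Pow[OF V(1)] UE by simp_all
  have "c + u + e \<le> N + 1"
    using card_intersections_cross_sperner[OF V(1) F nonempty(1) G cs]
    unfolding c_def ue N_def \<U>_def \<E>_def by linarith
  note N_ge = this
  have N_prod: "N \<le> u * e"
    using card_intersections_le_mult[OF fin] unfolding N_def ue by (simp flip: of_nat_mult)
  have "V \<in> \<U>" using F nonempty unfolding \<U>_def up_closure_def by blast
  then have ue1: "1 \<le> u" "1 \<le> e"
    using fin card_gt_0_iff[of \<U>] card_gt_0_iff[of \<E>] unfolding ue \<E>_def by fastforce+
  have c_prod: "c \<le> (u - 1) * (e - 1)" using N_ge N_prod by (simp add: algebra_simps)
  have ue_ge: "P + Q \<le> u + e"
  proof (rule ccontr)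
    assume "\<not> P + Q \<le> u + e"
    then have less: "u + e < P + Q" by simp
    show False
    proof (cases "even n")
      case True
      then have "P = Q" by (auto simp: PQ pq elim!: evenE)
      \<comment> \<open>AM-GM for \<open>u - 1\<close> and \<open>e - 1\<close>, written with
        squares.\<close>
      have "(u + e - 2)\<^sup>2 < (2 * (P - 1))\<^sup>2"
        using less \<open>P = Q\<close> ue1 P2 by (intro power_strict_mono) auto
      moreover have "0 \<le> (u - e)\<^sup>2" by simp
      ultimately have "(u - 1) * (e - 1) < (P - 1) * (P - 1)"
        by (simp add: power2_eq_square algebra_simps)
      then show False using c_prod c_ge \<open>P = Q\<close> by simp
    next
      case False
      then have QP: "Q = 2 * P" by (auto simp: PQ pq elim!: oddE)
      show False
      proof (cases "P \<le> u \<or> P \<le> e")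
        case True
        \<comment> \<open>Now \<open>2 * P * P = 2 ^ n\<close>, so both parameters can be
          \<open>P = 2 ^ p / 2 ^ 0\<close>.\<close>
        have "N \<le> P * u + P * e - P * P"
          unfolding N_def ue
        proof (rule card_intersections_up_closed_le[OF V(1) _ UE(2), of _ _ p 0])
          show "up_closed V \<U>" unfolding \<U>_def by (rule up_closed_up_closure)
        qed (use True PQ_mult QP V in \<open>simp_all add: ue PQ\<close>)
        then have "c \<le> (P - 1) * (u + e) - P * P + 1"
          using N_ge by (simp add: algebra_simps)
        also have "\<dots> < (P - 1) * (P + Q) - P * P + 1"
          using less P2 by simp
        also have "\<dots> = (P - 1) * (Q - 1)"
          by (simp add: QP algebra_simps)
        finally show False using c_ge by simp
      next
        case False
        then have "(u - 1) * (e - 1) \<le> (P - 1) * (P - 1)"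
          using ue1 by (intro mult_mono) auto
        also have "\<dots> < (P - 1) * (Q - 1)"
          using P2 QP by (intro mult_strict_left_mono) auto
        finally show False using c_prod c_ge by simp
      qed
    qed
  qed
  have "2 ^ n \<le> N"
    using ue_ge N_ge c_ge PQ_mult by (simp add: algebra_simps)
  then have "card (Pow V) \<le> card (intersections \<U> \<E>)"
    using V unfolding N_def by (simp add: card_Pow flip: of_nat_le_iff)
  then have "intersections \<U> \<E> = Pow V"
    using V intersections_subset_Pow[OF UE(1)] by (intro card_seteq) auto
  then obtain A B where AB: "A \<in> \<U>" "B \<in> \<E>" "A \<inter> B = {}"
  proof -
    have "{} \<in> intersections \<U> \<E>" using \<open>intersections \<U> \<E> = Pow V\<close> by simp
    then show ?thesis using that unfolding intersections_def by auto
  qed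
  from AB(1) obtain A' where A': "A' \<in> \<F>" "A' \<subseteq> A" "A \<subseteq> V" by (auto simp: \<U>_def up_closure_def)
  \<comment> \<open>\<open>V\<close> is the only member of \<open>\<E>\<close> that need not lie
    above a member of \<open>\<G>\<close>.\<close>
  have "B \<noteq> V"
  proof
    assume "B = V"
    then have "A' = {}" using AB(3) A' by blast
    then show False using A'(1) nonempty(2) cs by (auto simp: cross_sperner_def)
  qed
  with AB(2) obtain B' where B': "B' \<in> \<G>" "B' \<subseteq> B" by (auto simp: \<E>_def up_closure_def)
  have "A' \<inter> B' \<subseteq> A \<inter> B" using A'(2) B'(2) by (rule Int_mono)
  then have "A' \<inter> B' = {}" using AB(3) by simp
  then show ?thesis using A'(1) B'(1) by blast
qed

section \<open>The extremal family of intersections\<close>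

text \<open>For complementary \<open>X\<close> and \<open>Y\<close> of balanced sizes these are the
  intersections of an extremal pair; the ground set is implicitly
  \<open>X \<union> Y\<close>.\<close>

definition avoiding :: "'a set \<Rightarrow> 'a set \<Rightarrow> 'a set set" where
  "avoiding X Y = {S. S \<subseteq> X \<union> Y \<and> \<not> X \<subseteq> S \<and> \<not> Y \<subseteq> S}"

text \<open>The traces on \<open>X\<close> and \<open>Y\<close> are independent proper
  subsets.\<close>

lemma card_avoiding:
  assumes "finite X" "finite Y" "X \<inter> Y = {}"
  shows "card (avoiding X Y) = (2 ^ card X - 1) * (2 ^ card Y - 1)"
proof -
  have "bij_betw (\<lambda>(A, B). A \<union> B) ((Pow X - {X}) \<times> (Pow Y - {Y})) (avoiding X Y)"
    by (rule bij_betw_byWitness[where f' = "\<lambda>S. (S \<inter> X, S \<inter> Y)"])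
      (use assms(3) in \<open>auto simp: avoiding_def\<close>)
  then have "card (avoiding X Y) = card ((Pow X - {X}) \<times> (Pow Y - {Y}))"
    by (simp add: bij_betw_same_card)
  then show ?thesis using assms by (simp add: card_cartesian_product card_Pow)
qed

text \<open>If one exponent drops below \<open>n div 2\<close>, the other exceeds
  \<open>(n + 1) div 2\<close>, and its power alone is at least the balanced sum.\<close>

lemma power_sum_ge_balanced:
  fixes a b n :: nat
  assumes "a + b = n"
  shows "(2::nat) ^ (n div 2) + 2 ^ ((n + 1) div 2) \<le> 2 ^ a + 2 ^ b"
    and "(2::nat) ^ (n div 2) + 2 ^ ((n + 1) div 2) = 2 ^ a + 2 ^ b \<Longrightarrow>
      {a, b} = {n div 2, (n + 1) div 2}"
proof -
  define p q where pq: "p = n div 2" "q = (n + 1) div 2"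
  have less: "(2::nat) ^ p + 2 ^ q < 2 ^ x + 2 ^ y" if "x + y = n" "x < p" for x y
  proof -
    have "p \<le> q" "Suc q \<le> y" using that by (auto simp: pq)
    then have "(2::nat) ^ p \<le> 2 ^ q" "(2::nat) ^ Suc q \<le> 2 ^ y"
      by (auto intro!: power_increasing simp del: power_Suc)
    moreover have "(0::nat) < 2 ^ x" by simp
    ultimately show ?thesis unfolding power_Suc by linarith
  qed
  consider "a < p" | "b < p" | "a = p" "b = q" | "a = q" "b = p"
    using assms by (fastforce simp: pq)
  then have "2 ^ p + 2 ^ q \<le> (2::nat) ^ a + 2 ^ b \<and>
    ((2::nat) ^ p + 2 ^ q = 2 ^ a + 2 ^ b \<longrightarrow> {a, b} = {p, q})"
    using less[of a b] less[of b a] assms by cases auto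
  then show "(2::nat) ^ (n div 2) + 2 ^ ((n + 1) div 2) \<le> 2 ^ a + 2 ^ b"
    "(2::nat) ^ (n div 2) + 2 ^ ((n + 1) div 2) = 2 ^ a + 2 ^ b \<Longrightarrow>
      {a, b} = {n div 2, (n + 1) div 2}"
    by (auto simp: pq)
qed

lemma power_pred_mult:
  "((2::nat) ^ a - 1) * (2 ^ b - 1) + (2 ^ a + 2 ^ b) = 2 ^ (a + b) + 1"
proof -
  obtain x y where "(2::nat) ^ a = Suc x" "(2::nat) ^ b = Suc y"
    by (metis not0_implies_Suc power_not_zero zero_neq_numeral)
  then show ?thesis by (simp add: power_add)
qed

text \<open>It suffices that the complement of each \<open>y\<close> in \<open>Y\<close> belongs to
  \<open>\<G>\<close>, because \<open>A\<close> is not contained in it.\<close>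

lemma cross_sperner_avoiding_superset:
  assumes "X \<inter> Y = {}" and F: "\<F> \<subseteq> Pow (X \<union> Y)" and G: "\<G> \<subseteq> Pow (X \<union> Y)" and cs: "cross_sperner \<F> \<G>"
    and Y: "Y \<in> \<F>" and X: "X \<in> \<G>" and I: "intersections \<F> \<G> = avoiding X Y" and "A \<in> \<F>"
  shows "Y \<subseteq> A"
proof
  fix y assume y: "y \<in> Y"
  have "\<not> X \<subseteq> Y" using cs X Y by (auto simp: cross_sperner_def)
  then obtain x where x: "x \<in> X" by blast
  \<comment> \<open>Omitting one point of each block gives a set in \<open>avoiding X Y\<close>. Its
    part \<open>B\<close> from \<open>\<G>\<close> must miss \<open>y\<close>, having no room to
    miss another point of \<open>Y\<close>, and must contain \<open>x\<close>, as otherwise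
    \<open>B\<close> would lie in \<open>A'\<close>.\<close>
  have "X \<union> Y - {x, y} \<in> intersections \<F> \<G>"
    unfolding I avoiding_def using x y by blast
  then obtain A' B where AB: "A' \<in> \<F>" "B \<in> \<G>" "X \<union> Y - {x, y} = A' \<inter> B"
    by (auto simp: intersections_def)
  have B: "B \<subseteq> X \<union> Y" "X \<union> Y - {x, y} \<subseteq> B" using AB G by blast+
  have "\<not> Y \<subseteq> B" using cs Y AB(2) by (auto simp: cross_sperner_def)
  then have "y \<notin> B" using B(2) assms(1) x by blast
  then have "B \<subseteq> X \<union> Y - {y}" using B(1) by blast
  moreover have "x \<in> B"
  proof (rule ccontr)
    assume "x \<notin> B"
    then have "B \<subseteq> A'" using AB(3) \<open>y \<notin> B\<close> B(1) by blast
    then show False using cs AB by (auto simp: cross_sperner_def)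
  qed
  then have "X \<union> Y - {y} \<subseteq> B" using B(2) by blast
  ultimately have "X \<union> Y - {y} \<in> \<G>" using AB(2) by (simp add: subset_antisym)
  then have "\<not> A \<subseteq> X \<union> Y - {y}" using cs \<open>A \<in> \<F>\<close> by (auto simp: cross_sperner_def)
  then show "y \<in> A" using F \<open>A \<in> \<F>\<close> by blast
qed

lemma avoiding_commute: "avoiding X Y = avoiding Y X"
  by (auto simp: avoiding_def)

text \<open>Each proper subset \<open>A\<close> of \<open>X\<close> is an intersection
  \<open>A' \<inter> B\<close>. Since \<open>Y \<subseteq> A'\<close> and, by symmetry,
  \<open>X \<subseteq> B\<close>, the set \<open>A'\<close> must be
  \<open>A \<union> Y\<close>.\<close>

lemma cross_sperner_avoiding_family:
  assumes "X \<inter> Y = {}" and F: "\<F> \<subseteq> Pow (X \<union> Y)" and G: "\<G> \<subseteq> Pow (X \<union> Y)" and cs: "cross_sperner \<F> \<G>"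
    and Y: "Y \<in> \<F>" and X: "X \<in> \<G>" and I: "intersections \<F> \<G> = avoiding X Y"
  shows "\<F> = {A \<union> Y | A. A \<subset> X}"
proof (intro set_eqI iffI)
  fix A assume A: "A \<in> \<F>"
  then have "Y \<subseteq> A" by (rule cross_sperner_avoiding_superset[OF assms])
  moreover have "\<not> X \<subseteq> A" using cs X A by (auto simp: cross_sperner_def)
  moreover have "A \<subseteq> X \<union> Y" using A F by blast
  ultimately have "A = (A \<inter> X) \<union> Y" "A \<inter> X \<subset> X" by blast+
  then show "A \<in> {A \<union> Y | A. A \<subset> X}" by blast
next
  fix S assume "S \<in> {A \<union> Y | A. A \<subset> X}"
  then obtain A where A: "S = A \<union> Y" "A \<subset> X" by blast
  \<comment> \<open>So \<open>Y\<close> is nonempty, and \<open>A\<close>, being disjoint from it,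
    cannot contain it.\<close>
  have "\<not> Y \<subseteq> X" using cs X Y by (auto simp: cross_sperner_def)
  then have "A \<in> intersections \<F> \<G>"
    unfolding I avoiding_def using A(2) by blast
  then obtain A' B where AB: "A' \<in> \<F>" "B \<in> \<G>" "A = A' \<inter> B"
    by (auto simp: intersections_def)
  have "X \<subseteq> B"
    by (rule cross_sperner_avoiding_superset[of Y X \<G> \<F>])
      (use assms AB in \<open>simp_all add: Int_commute Un_commute cross_sperner_commute[of \<G>]
        intersections_commute[of \<G>] avoiding_commute[of Y]\<close>)
  moreover have "Y \<subseteq> A'" by (rule cross_sperner_avoiding_superset[OF assms AB(1)])
  moreover have "A' \<subseteq> X \<union> Y" using AB(1) F by blast
  ultimately have "A' = S" using AB(3) A by blast
  then show "S \<in> \<F>" using AB by simp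
qed

section \<open>Upper bound and uniqueness\<close>

lemma card_intersections_cross_sperner_le:
  fixes n :: nat
  assumes V: "finite V" "card V = n" and n: "n > 1"
    and F: "\<F> \<subseteq> Pow V" and G: "\<G> \<subseteq> Pow V" and cs: "cross_sperner \<F> \<G>"
  defines "m \<equiv> (2 ^ (n div 2) - 1) * (2 ^ ((n + 1) div 2) - 1)"
  shows "card (intersections \<F> \<G>) \<le> m"
    and "card (intersections \<F> \<G>) = m \<Longrightarrow> \<exists>X Y. X \<inter> Y = {} \<and> X \<union> Y = V \<and>
      {card X, card Y} = {n div 2, (n + 1) div 2} \<and>
      \<F> = {A \<union> Y | A. A \<subset> X} \<and> \<G> = {B \<union> X | B. B \<subset> Y}"
proof -
  have main: "card (intersections \<F> \<G>) = m \<and> (\<exists>X Y. X \<inter> Y = {} \<and> X \<union> Y = V \<and>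
      {card X, card Y} = {n div 2, (n + 1) div 2} \<and>
      \<F> = {A \<union> Y | A. A \<subset> X} \<and> \<G> = {B \<union> X | B. B \<subset> Y})"
    if large: "m \<le> card (intersections \<F> \<G>)"
  proof -
    obtain A B where AB: "A \<in> \<F>" "B \<in> \<G>" "A \<inter> B = {}"
      using cross_sperner_disjoint_members[OF V n F G cs] large unfolding m_def by blast
    have BV: "B \<subseteq> V" and AV: "A \<subseteq> V - B" using AB F G by blast+
    \<comment> \<open>At this point only \<open>A \<subseteq> Y\<close> is known; equality follows
      from extremality below.\<close>
    define Y where "Y = V - B"
    have BY: "B \<inter> Y = {}" "B \<union> Y = V" using BV by (auto simp: Y_def)
    have fin: "finite B" "finite Y" using V BV by (auto simp: Y_def finite_subset)
    have card_sum: "card B + card Y = n" using card_Un_disjoint[OF fin BY(1)] BY V by simp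
    have sub: "intersections \<F> \<G> \<subseteq> avoiding B Y"
    proof
      fix S assume "S \<in> intersections \<F> \<G>"
      then obtain A' B' where S: "A' \<in> \<F>" "B' \<in> \<G>" "S = A' \<inter> B'"
        by (auto simp: intersections_def)
      have "\<not> B \<subseteq> A'" "\<not> A \<subseteq> B'" using cs S AB by (auto simp: cross_sperner_def)
      moreover have "A' \<subseteq> B \<union> Y" using S F BY by blast
      ultimately show "S \<in> avoiding B Y"
        using S(3) AV unfolding avoiding_def Y_def by blast
    qed
    have fin_av: "finite (avoiding B Y)"
      by (rule finite_subset_Pow[OF V(1)]) (use BY in \<open>auto simp: avoiding_def\<close>)
    have card_av: "card (avoiding B Y) + (2 ^ card B + 2 ^ card Y) = 2 ^ n + 1"
      using card_avoiding[OF fin BY(1)] power_pred_mult[of "card B" "card Y"] card_sum by simp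
    have "n div 2 + (n + 1) div 2 = n" by linarith
    then have m_sum: "m + (2 ^ (n div 2) + 2 ^ ((n + 1) div 2)) = 2 ^ n + 1"
      unfolding m_def using power_pred_mult[of "n div 2" "(n + 1) div 2"] by simp
    note balanced = power_sum_ge_balanced[OF card_sum]
    have "card (intersections \<F> \<G>) \<le> card (avoiding B Y)" by (rule card_mono[OF fin_av sub])
    \<comment> \<open>The chain from \<open>m\<close> through both cardinalities closes up, since
      the balanced split makes \<open>m\<close> the largest possible size of
      \<open>avoiding B Y\<close>.\<close>
    then have eq: "card (intersections \<F> \<G>) = m" "card (avoiding B Y) = m"
      using balanced(1) card_av m_sum large by linarith+
    then have I: "intersections \<F> \<G> = avoiding B Y"
      using card_subset_eq[OF fin_av sub] by simp
    have card_BY: "{card B, card Y} = {n div 2, (n + 1) div 2}"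
      using eq(2) card_av m_sum by (intro balanced(2)) linarith
    have "A = Y"
    proof (rule ccontr)
      assume "A \<noteq> Y"
      moreover have "\<not> B \<subseteq> A" using cs AB by (auto simp: cross_sperner_def)
      \<comment> \<open>A proper subset \<open>A\<close> of \<open>Y\<close> would itself be an
        intersection, hence contained in a member of \<open>\<G>\<close>.\<close>
      ultimately have "A \<in> intersections \<F> \<G>"
        unfolding I avoiding_def using AV by (auto simp: Y_def)
      then obtain A' B' where S: "A' \<in> \<F>" "B' \<in> \<G>" "A = A' \<inter> B'"
        by (auto simp: intersections_def)
      then show False using cs AB(1) by (auto simp: cross_sperner_def)
    qed
    then have Y: "Y \<in> \<F>" using AB by simp
    have FG: "\<F> \<subseteq> Pow (B \<union> Y)" "\<G> \<subseteq> Pow (B \<union> Y)" using F G BY by simp_all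
    have "\<F> = {A \<union> Y | A. A \<subset> B}"
      by (rule cross_sperner_avoiding_family[OF BY(1) FG cs Y AB(2) I])
    moreover have "\<G> = {A \<union> B | A. A \<subset> Y}"
      by (rule cross_sperner_avoiding_family[of Y B \<G> \<F>])
        (use BY(1) FG cs Y AB(2) I in \<open>simp_all add: Int_commute Un_commute
          cross_sperner_commute[of \<G>] intersections_commute[of \<G>] avoiding_commute[of Y]\<close>)
    ultimately show ?thesis using eq(1) BY card_BY by blast
  qed
  show "card (intersections \<F> \<G>) \<le> m" using main by linarith
  show "\<exists>X Y. X \<inter> Y = {} \<and> X \<union> Y = V \<and>
      {card X, card Y} = {n div 2, (n + 1) div 2} \<and>
      \<F> = {A \<union> Y | A. A \<subset> X} \<and> \<G> = {B \<union> X | B. B \<subset> Y}"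
    if "card (intersections \<F> \<G>) = m"
    using main that by simp
qed

section \<open>The construction and the value of the maximum\<close>

lemma cross_sperner_split:
  assumes "X \<inter> Y = {}"
  shows "cross_sperner {A \<union> Y | A. A \<subset> X} {B \<union> X | B. B \<subset> Y}"
  unfolding cross_sperner_def using assms by blast

text \<open>For \<open>A \<subseteq> X\<close> and \<open>B \<subseteq> Y\<close>, the set
  \<open>(A \<union> Y) \<inter> (B \<union> X)\<close> is just \<open>A \<union> B\<close>.\<close>

lemma intersections_split:
  assumes "X \<inter> Y = {}"
  shows "intersections {A \<union> Y | A. A \<subset> X} {B \<union> X | B. B \<subset> Y} = avoiding X Y"
proof (intro set_eqI iffI)
  fix S assume "S \<in> intersections {A \<union> Y | A. A \<subset> X} {B \<union> X | B. B \<subset> Y}"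
  then obtain A B where "S = (A \<union> Y) \<inter> (B \<union> X)" "A \<subset> X" "B \<subset> Y"
    by (auto simp: intersections_def)
  then show "S \<in> avoiding X Y" unfolding avoiding_def using assms by blast
next
  fix S assume S: "S \<in> avoiding X Y"
  then have "S = (S \<inter> X \<union> Y) \<inter> (S \<inter> Y \<union> X)" "S \<inter> X \<subset> X" "S \<inter> Y \<subset> Y"
    unfolding avoiding_def using assms by blast+
  then show "S \<in> intersections {A \<union> Y | A. A \<subset> X} {B \<union> X | B. B \<subset> Y}"
    unfolding intersections_def by blast
qed

lemma max_intersections_eq:
  fixes n :: nat
  assumes "n > 1"
  shows "max_intersections n = (2 ^ (n div 2) - 1) * (2 ^ ((n + 1) div 2) - 1)"
  unfolding max_intersections_def
proof (rule Max_eqI)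
  let ?S = "{card (intersections \<F> \<G>) | \<F> \<G>.
    \<F> \<subseteq> Pow {1..n} \<and> \<G> \<subseteq> Pow {1..n} \<and> cross_sperner \<F> \<G>}"
  have le: "k \<le> (2 ^ (n div 2) - 1) * (2 ^ ((n + 1) div 2) - 1)" if "k \<in> ?S" for k
    using that card_intersections_cross_sperner_le(1)[of "{1..n}", OF _ _ assms] by auto
  then show "\<And>k. k \<in> ?S \<Longrightarrow> k \<le> (2 ^ (n div 2) - 1) * (2 ^ ((n + 1) div 2) - 1)" .
  \<comment> \<open>A bounded set of natural numbers is finite.\<close>
  show "finite ?S"
    using le by (meson atMost_iff finite_atMost finite_subset subsetI)
  define X Y where XY: "X = {1..n div 2}" "Y = {n div 2 + 1..n}"
  have disj: "X \<inter> Y = {}" and un: "X \<union> Y = {1..n}" by (auto simp: XY)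
  have card: "card X = n div 2" "card Y = (n + 1) div 2" by (auto simp: XY)
  have "card (avoiding X Y) = (2 ^ (n div 2) - 1) * (2 ^ ((n + 1) div 2) - 1)"
    using card_avoiding[of X Y] disj card by (simp add: XY)
  moreover have "{A \<union> Y | A. A \<subset> X} \<subseteq> Pow {1..n}" "{B \<union> X | B. B \<subset> Y} \<subseteq> Pow {1..n}"
    unfolding un[symmetric] by blast+
  ultimately show "(2 ^ (n div 2) - 1) * (2 ^ ((n + 1) div 2) - 1) \<in> ?S"
    using cross_sperner_split[OF disj] intersections_split[OF disj] by (metis (mono_tags, lifting) mem_Collect_eq)
qed

theorem theorem1p2:
  fixes n :: nat
  assumes "n > 1"
  shows "(\<forall>\<F> \<G>. \<F> \<subseteq> Pow {1..n} \<and> \<G> \<subseteq> Pow {1..n} \<and> cross_sperner \<F> \<G> \<and>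
             card (intersections \<F> \<G>) = max_intersections n \<longrightarrow>
           (\<exists>X Y. X \<inter> Y = {} \<and> X \<union> Y = {1..n} \<and>
              {card X, card Y} = {n div 2, (n + 1) div 2} \<and>
              \<F> = {A \<union> Y | A. A \<subset> X} \<and> \<G> = {B \<union> X | B. B \<subset> Y})) \<and>
         int (max_intersections n) = 2 ^ n - 2 ^ (n div 2) - 2 ^ ((n + 1) div 2) + 1"
proof (intro conjI allI impI)
  fix \<F> \<G> :: "nat set set"
  assume "\<F> \<subseteq> Pow {1..n} \<and> \<G> \<subseteq> Pow {1..n} \<and> cross_sperner \<F> \<G> \<and>
    card (intersections \<F> \<G>) = max_intersections n"
  then show "\<exists>X Y. X \<inter> Y = {} \<and> X \<union> Y = {1..n} \<and>
      {card X, card Y} = {n div 2, (n + 1) div 2} \<and>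
      \<F> = {A \<union> Y | A. A \<subset> X} \<and> \<G> = {B \<union> X | B. B \<subset> Y}"
    by (intro card_intersections_cross_sperner_le(2)[OF _ _ assms])
      (simp_all add: max_intersections_eq[OF assms])
next
  have "n div 2 + (n + 1) div 2 = n" by linarith
  then have "max_intersections n + (2 ^ (n div 2) + 2 ^ ((n + 1) div 2)) = 2 ^ n + 1"
    using power_pred_mult[of "n div 2" "(n + 1) div 2"] by (simp only: max_intersections_eq[OF assms])
  \<comment> \<open>The cast is applied to the additive form, so no truncated subtraction has to be
    cast.\<close>
  then have "int (max_intersections n + (2 ^ (n div 2) + 2 ^ ((n + 1) div 2))) = int (2 ^ n + 1)"
    by (simp only:)
  then show "int (max_intersections n) = 2 ^ n - 2 ^ (n div 2) - 2 ^ ((n + 1) div 2) + 1"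
    by simp
qed

end
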